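(* Let $n,m\ge1$ and $1\le k\le n$ be integers, and let $u:[0,1]^{n\times m}\to\mathbb{R}^n$ be a $\lambda$-Lipschitz utility function. The top-$k$ softmax rule with temperature $\tau>0$ applied to the utilities $u(X)$ induces $L$-smooth marginal selection probabilities with $$L\le\frac{2\lambda}{e\,\tau},$$ and its worst-case regret satisfies $$\max_{X\in[0,1]^{n\times m}}\mathrm{Regret}(X)\le k\,\tau\log n.$$
   Context: Here $e$ is Euler's number and $\log$ is the natural logarithm. $X\in[0,1]^{n\times m}$ is a review matrix and $\|A\|_{1,1}=\sum_{i,j}|A_{i,j}|$. A utility function $u:[0,1]^{n\times m}\to\mathbb{R}^n$ is $\lambda$-Lipschitz if $\|u(X)-u(X')\|_1\le\lambda\|X-X'\|_{1,1}$ for all $X,X'$. Top-$k$ softmax rule with temperature $\tau$: given utilities $v=u(X)\in\mathbb{R}^n$, sample $k$ items from $[n]=\{1,\dots,n\}$ without replacement, sequentially: at each step, if $R\subseteq[n]$ is the set of remaining items, choose $i\in R$ with probability $e^{v_i/\tau}/\sum_{j\in R}e^{v_j/\tau}$. (Equivalently: add i.i.d. Gumbel noise with location $0$ and scale $\tau$ to the $v_i$ and select the $k$ largest perturbed values.) The output is the set $S$ of the $k$ chosen items. Marginal selection probabilities: $p_i(X)=\Pr[i\in S]$. They are $L$-smooth if $\|p(X)-p(X')\|_1\le L\|X-X'\|_{1,1}$ for all $X,X'\in[0,1]^{n\times m}$. Regret: $\mathrm{Regret}(X)=\mathrm{OPT}(X)-p(X)^\top u(X)$, where $\mathrm{OPT}(X)$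 is the sum of the $k$ largest entries of $u(X)$. *)

theory Defs
  imports "HOL-Probability.Probability"
begin

text \<open>
  Review matrices are \<open>n \<times> m\<close> with \<open>n = CARD('n)\<close> items (rows) and \<open>m = CARD('m)\<close> columns.
  Utility functions are total in HOL; all conditions on them are restricted to \<open>review_matrices\<close>.
\<close>

definition review_matrices :: "(real^'m^'n) set"
  where "review_matrices = {X. \<forall>i j. X $ i $ j \<in> {0..1}}"

definition norm1 :: "real^'n \<Rightarrow> real"
  where "norm1 v = (\<Sum>i\<in>UNIV. \<bar>v $ i\<bar>)"

definition norm11 :: "real^'m^'n \<Rightarrow> real"
  where "norm11 A = (\<Sum>i\<in>UNIV. \<Sum>j\<in>UNIV. \<bar>A $ i $ j\<bar>)"

definition lipschitz_utility :: "real \<Rightarrow> (real^'m^'n \<Rightarrow> real^'n) \<Rightarrow> bool"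
  where "lipschitz_utility lam u \<longleftrightarrow>
    (\<forall>X\<in>review_matrices. \<forall>X'\<in>review_matrices. norm1 (u X - u X') \<le> lam * norm11 (X - X'))"

text \<open>
  One softmax draw from the set \<open>R\<close> of remaining items. It is only meaningful for \<open>R \<noteq> {}\<close>
  (see \<open>pmf_softmax_pick\<close>).
\<close>

definition softmax_pick :: "real \<Rightarrow> real^'n \<Rightarrow> 'n set \<Rightarrow> 'n pmf"
  where "softmax_pick \<tau> v R =
    embed_pmf (\<lambda>i. if i \<in> R then exp (v $ i / \<tau>) / (\<Sum>j\<in>R. exp (v $ j / \<tau>)) else 0)"

lemma pmf_softmax_pick:
  fixes v :: "real^'n"
  assumes "R \<noteq> {}"
  shows "pmf (softmax_pick \<tau> v R) i =
    (if i \<in> R then exp (v $ i / \<tau>) / (\<Sum>j\<in>R. exp (v $ j / \<tau>)) else 0)"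
proof -
  let ?Z = "\<Sum>j\<in>R. exp (v $ j / \<tau>)"
  let ?f = "\<lambda>i. if i \<in> R then exp (v $ i / \<tau>) / ?Z else 0"
  have Z: "?Z > 0"
    using assms by (intro sum_pos) auto
  have nonneg: "0 \<le> ?f j" for j
    using Z by simp
  have "(\<Sum>j\<in>UNIV. ?f j) = (\<Sum>j\<in>R. exp (v $ j / \<tau>) / ?Z)"
    by (simp add: sum.If_cases)
  also have "\<dots> = 1"
    using Z by (simp flip: sum_divide_distrib)
  finally have "(\<integral>\<^sup>+j. ennreal (?f j) \<partial>count_space UNIV) = 1"
    using nonneg by (simp add: nn_integral_count_space_finite sum_ennreal)
  then show ?thesis
    unfolding softmax_pick_def using nonneg by (subst pmf_embed_pmf) auto
qed

text \<open>
  Law of the set of items obtained by \<open>k\<close> successive draws without replacement from \<open>R\<close>;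
  the set of remaining items never runs empty before the last draw if \<open>k \<le> card R\<close>.
\<close>

primrec softmax_draws :: "real \<Rightarrow> real^'n \<Rightarrow> nat \<Rightarrow> 'n set \<Rightarrow> 'n set pmf"
  where
    "softmax_draws \<tau> v 0 R = return_pmf {}"
  | "softmax_draws \<tau> v (Suc k) R =
      bind_pmf (softmax_pick \<tau> v R) (\<lambda>i. map_pmf (insert i) (softmax_draws \<tau> v k (R - {i})))"

definition topk_softmax :: "nat \<Rightarrow> real \<Rightarrow> real^'n \<Rightarrow> 'n set pmf"
  where "topk_softmax k \<tau> v = softmax_draws \<tau> v k UNIV"

definition selection_prob ::
    "nat \<Rightarrow> real \<Rightarrow> (real^'m^'n \<Rightarrow> real^'n) \<Rightarrow> real^'m^'n \<Rightarrow> real^'n"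
  where "selection_prob k \<tau> u X =
    (\<chi> i. measure_pmf.prob (topk_softmax k \<tau> (u X)) {S. i \<in> S})"

definition smooth_selection :: "real \<Rightarrow> (real^'m^'n \<Rightarrow> real^'n) \<Rightarrow> bool"
  where "smooth_selection L p \<longleftrightarrow>
    (\<forall>X\<in>review_matrices. \<forall>X'\<in>review_matrices. norm1 (p X - p X') \<le> L * norm11 (X - X'))"

text \<open>Entries are collected in a multiset, so that ties are counted with multiplicity.\<close>

definition sum_k_largest :: "nat \<Rightarrow> real^'n \<Rightarrow> real"
  where "sum_k_largest k v =
    sum_list (take k (rev (sorted_list_of_multiset (image_mset (\<lambda>i. v $ i) (mset_set UNIV)))))"

definition regret :: "nat \<Rightarrow> real \<Rightarrow> (real^'m^'n \<Rightarrow> real^'n) \<Rightarrow> real^'m^'n \<Rightarrow> real"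
  where "regret k \<tau> u X = sum_k_largest k (u X) - selection_prob k \<tau> u X \<bullet> u X"

end

theory Submission
  imports Defs
begin

text \<open>
  Fix an item \<open>j\<close> of weight \<open>exp x\<close>. A run on all items is a run on the others into which \<open>j\<close> is
  inserted, so the probability that \<open>j\<close> is never drawn is a convex combination of products
  \<open>\<Prod>l. 1 / (1 + exp x / W l)\<close>. Such a product is \<open>exp (- g)\<close> with \<open>0 \<le> g' \<le> g\<close>, so its
  derivative is bounded by \<open>g * exp (- g) \<le> exp (- 1)\<close>. Insertion of \<open>j\<close> only lowers the other
  marginals, and all marginals sum to \<open>k\<close>, which gives the factor 2; changing the utilities one
  coordinate at a time proves smoothness. For the regret, the entropy bound shows that each draw
  loses at most \<open>\<tau> * ln n\<close> against the best remaining item.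
\<close>

section \<open>Sampling without replacement: monotonicity in a competitor's weight\<close>

text \<open>The chance that \<open>i\<close> is among \<open>k\<close> weighted draws from
  \<open>R\<close>, by recursion on the first draw. As a plain real function of \<open>w\<close> it
  can be studied while one weight varies; \<open>prob_softmax_draws\<close> links it to the pmf. On
  the empty set it is 0, so a run that exhausts its items simply stops.\<close>

primrec inclusion_prob :: "('a \<Rightarrow> real) \<Rightarrow> nat \<Rightarrow> 'a set \<Rightarrow> 'a \<Rightarrow> real"
  where
    "inclusion_prob w 0 R i = 0"
  | "inclusion_prob w (Suc k) R i =
      (\<Sum>a\<in>R. w a / sum w R * (if a = i then 1 else inclusion_prob w k (R - {a}) i))"

lemma inclusion_prob_cong:
  assumes "\<And>a. a \<in> R \<Longrightarrow> w a = w' a"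
  shows "inclusion_prob w k R i = inclusion_prob w' k R i"
  using assms
proof (induction k arbitrary: R)
  case (Suc k)
  have "sum w R = sum w' R"
    using Suc.prems by (intro sum.cong) auto
  moreover have "inclusion_prob w k (R - {a}) i = inclusion_prob w' k (R - {a}) i" for a
    using Suc.prems by (intro Suc.IH) auto
  ultimately show ?case
    using Suc.prems by (auto intro!: sum.cong)
qed simp

text \<open>
  Inserting the item \<open>j\<close> into a run on \<open>R\<close> displaces at most the last of the \<open>k + 1\<close> draws; the
  displacement is less likely the smaller the weight of \<open>j\<close>.
\<close>

lemma inclusion_prob_insert_excess:
  fixes w :: "'a \<Rightarrow> real"
  assumes "finite R" "j \<notin> R" "i \<noteq> j" and w: "\<And>a. w a > 0"
  shows "inclusion_prob w (Suc (Suc k)) (insert j R) i - inclusion_prob w (Suc k) R i =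
    (\<Sum>a\<in>R. w a / (w j + sum w R) *
      (if a = i then 0 else inclusion_prob w (Suc k) (insert j (R - {a})) i - inclusion_prob w k (R - {a}) i))"
proof (cases "R = {}")
  case True
  then show ?thesis using assms by simp
next
  case False
  have W: "sum w R > 0" using False assms by (intro sum_pos) auto
  define Z where "Z = w j + sum w R"
  have Z: "Z > 0" using W w[of j] by (simp add: Z_def)
  define I where "I = inclusion_prob w (Suc k) R i"
  have diff: "insert j R - {a} = insert j (R - {a})" if "a \<in> R" for a
    using that assms by auto
  have "inclusion_prob w (Suc (Suc k)) (insert j R) i = w j / Z * I +
     (\<Sum>a\<in>R. w a / Z * (if a = i then 1 else inclusion_prob w (Suc k) (insert j R - {a}) i))"
    using assms by (simp add: Z_def I_def del: inclusion_prob.simps(2) add: inclusion_prob.simps(2)[of w "Suc k"])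
  also have "(\<Sum>a\<in>R. w a / Z * (if a = i then 1 else inclusion_prob w (Suc k) (insert j R - {a}) i)) =
     (\<Sum>a\<in>R. w a / Z * (if a = i then 1 else inclusion_prob w (Suc k) (insert j (R - {a})) i))"
    by (intro sum.cong refl) (simp add: diff del: inclusion_prob.simps)
  finally have 1: "inclusion_prob w (Suc (Suc k)) (insert j R) i = w j / Z * I +
     (\<Sum>a\<in>R. w a / Z * (if a = i then 1 else inclusion_prob w (Suc k) (insert j (R - {a})) i))" .
  \<comment> \<open>\<open>I\<close> is rewritten over the normaliser \<open>Z\<close> of the larger
    set, with the share \<open>w j / Z\<close> set aside. That share cancels in the difference:
    after a first draw of \<open>j\<close>, exactly \<open>Suc k\<close> draws from \<open>R\<close>
    remain, which also gives \<open>I\<close>.\<close>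
  have "sum w R / Z * I = (\<Sum>a\<in>R. w a / Z * (if a = i then 1 else inclusion_prob w k (R - {a}) i))"
    using W unfolding I_def inclusion_prob.simps sum_distrib_left
    by (intro sum.cong refl) simp
  moreover have "I = w j / Z * I + sum w R / Z * I"
    using Z unfolding Z_def by (simp flip: add_divide_distrib distrib_right)
  ultimately have 2: "I = w j / Z * I +
      (\<Sum>a\<in>R. w a / Z * (if a = i then 1 else inclusion_prob w k (R - {a}) i))" by simp
  have "inclusion_prob w (Suc (Suc k)) (insert j R) i - I =
     (\<Sum>a\<in>R. w a / Z * (if a = i then 1 else inclusion_prob w (Suc k) (insert j (R - {a})) i)) -
     (\<Sum>a\<in>R. w a / Z * (if a = i then 1 else inclusion_prob w k (R - {a}) i))"
    using 1 2 by linarith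
  also have "\<dots> = (\<Sum>a\<in>R. w a / Z *
      (if a = i then 0 else inclusion_prob w (Suc k) (insert j (R - {a})) i - inclusion_prob w k (R - {a}) i))"
    unfolding sum_subtractf[symmetric]
    by (intro sum.cong refl)
      (simp add: right_diff_distrib diff_divide_distrib del: inclusion_prob.simps)
  finally show ?thesis by (simp add: I_def Z_def del: inclusion_prob.simps)
qed

text \<open>In the recursion for the excess every coefficient has \<open>w j\<close> only in its
  denominator, so it shrinks as \<open>w j\<close> grows. Nonnegativity is carried through the
  induction because comparing products of coefficient and excess requires it.\<close>

lemma inclusion_prob_insert_excess_antimono:
  fixes w w' :: "'a \<Rightarrow> real"
  assumes "finite R" "j \<notin> R" "i \<noteq> j"
    and "\<And>a. w a > 0" "\<And>a. w' a > 0" "\<And>a. a \<noteq> j \<Longrightarrow> w a = w' a" "w j \<le> w' j"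
  shows "0 \<le> inclusion_prob w' (Suc k) (insert j R) i - inclusion_prob w' k R i \<and>
    inclusion_prob w' (Suc k) (insert j R) i - inclusion_prob w' k R i \<le> inclusion_prob w (Suc k) (insert j R) i - inclusion_prob w k R i"
  using assms(1,2)
proof (induction k arbitrary: R)
  case 0
  have eq: "sum w' R = sum w R"
    using 0 assms(6) by (intro sum.cong refl) metis
  have W: "sum w R \<ge> 0" using assms(4) by (intro sum_nonneg) (simp add: less_imp_le)
  have I: "inclusion_prob v (Suc 0) (insert j R) i = (if i \<in> R then v i / (v j + sum v R) else 0)" for v
    using 0 assms(3) by (auto simp: sum.delta if_distrib[of "\<lambda>x. _ * x"] cong: if_cong)
  have "w i / (w' j + sum w R) \<le> w i / (w j + sum w R)"
    using assms(4)[of i] assms(4)[of j] assms(7) W by (intro divide_left_mono mult_pos_pos) auto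
  moreover have "0 \<le> w i / (w' j + sum w R)"
    using assms(4)[of i] assms(5)[of j] W by simp
  ultimately show ?case
    unfolding I using assms(3) by (auto simp: eq assms(6)[symmetric])
next
  case (Suc k)
  have eq: "sum w' R = sum w R"
    using Suc.prems assms(6) by (intro sum.cong refl) metis
  have W: "sum w R \<ge> 0" using assms(4) by (intro sum_nonneg) (simp add: less_imp_le)
  have wa: "w' a = w a" if "a \<in> R" for a using that Suc.prems assms(6) by metis
  let ?e = "\<lambda>v a. if a = i then 0 else inclusion_prob v (Suc k) (insert j (R - {a})) i - inclusion_prob v k (R - {a}) i"
  have IH: "0 \<le> ?e w' a \<and> ?e w' a \<le> ?e w a" for a
    using Suc.IH[of "R - {a}"] Suc.prems by auto
  have Z: "0 < w j + sum w R" "0 < w' j + sum w R" "w j + sum w R \<le> w' j + sum w R"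
    using assms(4,5)[of j] assms(7) W by auto
  have c: "0 \<le> w a / (w' j + sum w R)" "w a / (w' j + sum w R) \<le> w a / (w j + sum w R)" for a
    using Z assms(4)[of a] by (auto intro!: divide_left_mono mult_pos_pos simp: less_imp_le)
  note ex = inclusion_prob_insert_excess[OF Suc.prems assms(3)]
  show ?case
    unfolding ex[of w, OF assms(4)] ex[of w', OF assms(5)] eq
  proof (intro conjI sum_nonneg sum_mono)
    fix a assume a: "a \<in> R"
    show "0 \<le> w' a / (w' j + sum w R) * ?e w' a"
      unfolding wa[OF a] by (intro mult_nonneg_nonneg c(1) conjunct1[OF IH])
    show "w' a / (w' j + sum w R) * ?e w' a \<le> w a / (w j + sum w R) * ?e w a"
      unfolding wa[OF a] using IH[of a] c[of a] by (intro mult_mono) (auto simp del: inclusion_prob.simps)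
  qed
qed

section \<open>Lipschitz dependence of an item's inclusion on its log-weight\<close>

text \<open>In the complement the first draw \<open>a = j\<close> contributes nothing, so the
  recursion runs over \<open>R\<close> only and \<open>j\<close> stays among the remaining items at
  every level.\<close>

lemma one_minus_inclusion_prob_insert:
  fixes w :: "'a \<Rightarrow> real"
  assumes "finite R" "j \<notin> R" and w: "\<And>a. w a > 0"
  shows "1 - inclusion_prob w (Suc k) (insert j R) j =
    (\<Sum>a\<in>R. w a / (w j + sum w R) * (1 - inclusion_prob w k (insert j (R - {a})) j))"
proof -
  have "sum w R \<ge> 0" using w by (intro sum_nonneg) (simp add: less_imp_le)
  then have Z: "w j + sum w R > 0" using w[of j] by simp
  have diff: "insert j R - {a} = insert j (R - {a})" if "a \<in> R" for a
    using that assms by auto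
  have "inclusion_prob w (Suc k) (insert j R) j = w j / (w j + sum w R) +
    (\<Sum>a\<in>R. w a / (w j + sum w R) * inclusion_prob w k (insert j (R - {a})) j)"
    using assms by (auto simp: diff intro!: sum.cong)
  moreover have "1 = w j / (w j + sum w R) + (\<Sum>a\<in>R. w a / (w j + sum w R))"
    using Z by (simp flip: add_divide_distrib sum_divide_distrib)
  ultimately show ?thesis
    by (simp add: sum_subtractf algebra_simps del: inclusion_prob.simps)
qed

text \<open>Origin of \<open>1 / e\<close>: the maximum lies at \<open>x = 1\<close>, where the
  tangent bound \<open>1 + y \<le> exp y\<close> with \<open>y = x - 1\<close> is sharp.\<close>

lemma mult_exp_minus_le: "x * exp (- x) \<le> exp (- 1 :: real)"
proof -
  have "x \<le> exp (x - 1)" using exp_ge_add_one_self[of "x - 1"] by simp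
  then have "x * exp (- x) \<le> exp (x - 1) * exp (- x)" by (intro mult_right_mono) auto
  also have "\<dots> = exp (- 1)" by (simp flip: exp_add)
  finally show ?thesis .
qed

text \<open>The condition \<open>d \<le> g x\<close> brings the derivative of
  \<open>exp (- g x)\<close> into the form of \<open>mult_exp_minus_le\<close>. The constant does
  not depend on \<open>g\<close>, hence later not on the number of draws.\<close>

lemma exp_minus_lipschitz:
  fixes g :: "real \<Rightarrow> real"
  assumes "\<And>x. \<exists>d. (g has_real_derivative d) (at x) \<and> 0 \<le> d \<and> d \<le> g x"
  shows "\<bar>exp (- g x) - exp (- g y)\<bar> \<le> exp (- 1) * \<bar>x - y\<bar>"
proof -
  obtain g' where g': "\<And>x. (g has_real_derivative g' x) (at x)" "\<And>x. 0 \<le> g' x" "\<And>x. g' x \<le> g x"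
    using assms by metis
  have der: "((\<lambda>x. exp (- g x)) has_real_derivative (- (exp (- g x) * g' x))) (at x within UNIV)" for x
    by (auto intro!: derivative_eq_intros g'(1))
  have "norm (- (exp (- g x) * g' x)) \<le> exp (- 1)" for x
  proof -
    have "g' x * exp (- g x) \<le> g x * exp (- g x)"
      using g'(3) by (intro mult_right_mono) auto
    also note mult_exp_minus_le
    finally show ?thesis using g'(2)[of x] by (simp add: mult.commute)
  qed
  from field_differentiable_bound[OF convex_UNIV der this] show ?thesis
    by simp
qed

text \<open>The function is minus the logarithm of the probability that one draw misses an item of
  weight \<open>exp x\<close>. With \<open>y = exp x / W\<close> its derivative is
  \<open>y / (1 + y)\<close>, and \<open>ln t \<le> t - 1\<close> at \<open>t = 1 / (1 + y)\<close>
  bounds that by \<open>ln (1 + y)\<close>.\<close>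

lemma ln_add_one_exp_deriv:
  fixes W x :: real
  assumes "W > 0"
  shows "\<exists>d. ((\<lambda>x. ln (1 + exp x / W)) has_real_derivative d) (at x) \<and> 0 \<le> d \<and> d \<le> ln (1 + exp x / W)"
proof (intro exI conjI)
  let ?y = "exp x / W"
  have y: "?y > 0" using assms by simp
  have "1 + ?y > 0" using y by linarith
  then show "((\<lambda>x. ln (1 + exp x / W)) has_real_derivative (?y / (1 + ?y))) (at x)"
    using assms by (auto intro!: derivative_eq_intros)
  show "0 \<le> ?y / (1 + ?y)" using assms by (intro divide_nonneg_nonneg add_nonneg_nonneg) auto
  have "- ln (1 + ?y) = ln (1 / (1 + ?y))" using y by (simp add: ln_div)
  also have "\<dots> \<le> 1 / (1 + ?y) - 1" using y by (intro ln_le_minus_one) simp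
  also have "\<dots> = - (?y / (1 + ?y))" using y by (simp add: field_simps)
  finally show "?y / (1 + ?y) \<le> ln (1 + ?y)" by simp
qed

text \<open>
  The prefactor \<open>exp (- g)\<close> accumulates the probabilities \<open>1 / (1 + exp x / W)\<close> that \<open>j\<close> was
  missed in the draws made so far, \<open>W\<close> being the remaining weight of the other items.
\<close>

lemma exclusion_lipschitz:
  fixes w :: "'a \<Rightarrow> real" and g :: "real \<Rightarrow> real"
  assumes "finite R" "j \<notin> R" and w: "\<And>a. w a > 0"
    and "\<And>x. \<exists>d. (g has_real_derivative d) (at x) \<and> 0 \<le> d \<and> d \<le> g x"
  shows "\<bar>exp (- g x) * (1 - inclusion_prob (w(j := exp x)) k (insert j R) j) -
      exp (- g y) * (1 - inclusion_prob (w(j := exp y)) k (insert j R) j)\<bar> \<le> exp (- 1) * \<bar>x - y\<bar>"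
  using assms(1,2,4)
proof (induction k arbitrary: R g)
  case 0
  show ?case using exp_minus_lipschitz[where g = g, OF 0(3)] by simp
next
  case (Suc k)
  show ?case
  proof (cases "R = {}")
    case True
    \<comment> \<open>With no other item left, \<open>j\<close> is drawn with certainty.\<close>
    have "1 - inclusion_prob (w(j := exp x)) (Suc k) (insert j R) j = 0" for x
      by (simp add: True)
    then show ?thesis by (simp only: mult_zero_right) simp
  next
    case False
    define W where "W = sum w R"
    have W: "W > 0" unfolding W_def using False Suc.prems w by (intro sum_pos) auto
    \<comment> \<open>\<open>h\<close> absorbs the miss probability of the present draw into the
      prefactor; the condition on \<open>g\<close> survives because it is preserved by sums.\<close>
    define h where "h x = g x + ln (1 + exp x / W)" for x
    have h: "\<exists>d. (h has_real_derivative d) (at x) \<and> 0 \<le> d \<and> d \<le> h x" for x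
    proof -
      from Suc.prems(3)[of x] ln_add_one_exp_deriv[OF W, of x] obtain d d' where
        "(g has_real_derivative d) (at x)" "0 \<le> d" "d \<le> g x"
        "((\<lambda>x. ln (1 + exp x / W)) has_real_derivative d') (at x)" "0 \<le> d'" "d' \<le> ln (1 + exp x / W)"
        by blast
      then have "(h has_real_derivative (d + d')) (at x) \<and> 0 \<le> d + d' \<and> d + d' \<le> h x"
        unfolding h_def by (auto intro!: derivative_intros)
      then show ?thesis by blast
    qed
    define F where "F a x = exp (- h x) * (1 - inclusion_prob (w(j := exp x)) k (insert j (R - {a})) j)" for a x
    \<comment> \<open>Given that the draw misses \<open>j\<close>, it yields \<open>a\<close> with
      probability \<open>w a / W\<close>, which is free of \<open>x\<close>. The result is a convex
      combination with fixed weights, so the Lipschitz constant of the \<open>F a\<close> carries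
      over unchanged.\<close>
    have split: "exp (- g x) * (1 - inclusion_prob (w(j := exp x)) (Suc k) (insert j R) j) =
      (\<Sum>a\<in>R. w a / W * F a x)" for x
    proof -
      let ?w = "w(j := exp x)"
      have sw: "sum ?w R = W" unfolding W_def using Suc.prems(2) by (intro sum.cong) auto
      have y: "1 + exp x / W > 0" using W by (simp add: add_pos_nonneg)
      have "exp (- h x) = exp (- g x) / (1 + exp x / W)"
        unfolding h_def using y by (simp add: exp_diff exp_minus divide_inverse flip: exp_add)
      then have eh: "exp (- h x) = exp (- g x) * (W / (exp x + W))"
        using W by (simp add: field_simps)
      have "1 - inclusion_prob ?w (Suc k) (insert j R) j =
        (\<Sum>a\<in>R. ?w a / (?w j + sum ?w R) * (1 - inclusion_prob ?w k (insert j (R - {a})) j))"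
        using Suc.prems w by (intro one_minus_inclusion_prob_insert) auto
      also have "\<dots> = (\<Sum>a\<in>R. w a / (exp x + W) * (1 - inclusion_prob ?w k (insert j (R - {a})) j))"
        unfolding sw using Suc.prems(2) by (intro sum.cong) auto
      finally show ?thesis
        unfolding F_def eh using W
        by (auto simp: sum_distrib_left simp del: inclusion_prob.simps intro!: sum.cong)
    qed
    have IH: "\<bar>F a x - F a y\<bar> \<le> exp (- 1) * \<bar>x - y\<bar>" for a
      unfolding F_def using Suc.prems by (intro Suc.IH h) auto
    have "\<bar>(\<Sum>a\<in>R. w a / W * F a x) - (\<Sum>a\<in>R. w a / W * F a y)\<bar>
       = \<bar>\<Sum>a\<in>R. w a / W * (F a x - F a y)\<bar>"
      by (simp add: sum_subtractf right_diff_distrib)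
    also have "\<dots> \<le> (\<Sum>a\<in>R. \<bar>w a / W * (F a x - F a y)\<bar>)" by (rule sum_abs)
    also have "\<dots> \<le> (\<Sum>a\<in>R. w a / W * (exp (- 1) * \<bar>x - y\<bar>))"
    proof (rule sum_mono)
      fix a
      have "0 \<le> w a / W" using w[of a] W by simp
      then show "\<bar>w a / W * (F a x - F a y)\<bar> \<le> w a / W * (exp (- 1) * \<bar>x - y\<bar>)"
        using mult_left_mono[OF IH[of a]] by (simp only: abs_mult abs_of_nonneg)
    qed
    also have "\<dots> = (\<Sum>a\<in>R. w a / W) * (exp (- 1) * \<bar>x - y\<bar>)"
      by (simp only: sum_distrib_right)
    also have "(\<Sum>a\<in>R. w a / W) = 1"
      using W by (simp add: W_def flip: sum_divide_distrib)
    finally show ?thesis unfolding split by simp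
  qed
qed

lemma inclusion_prob_self_lipschitz:
  fixes w :: "'a \<Rightarrow> real"
  assumes "finite R" "j \<notin> R" and "\<And>a. w a > 0"
  shows "\<bar>inclusion_prob (w(j := exp x)) k (insert j R) j - inclusion_prob (w(j := exp y)) k (insert j R) j\<bar>
    \<le> exp (- 1) * \<bar>x - y\<bar>"
proof -
  \<comment> \<open>Before the first draw the prefactor is 1, that is \<open>g = 0\<close>.\<close>
  have "\<exists>d. ((\<lambda>_. 0 :: real) has_real_derivative d) (at x) \<and> 0 \<le> d \<and> d \<le> 0" for x :: real
    by (intro exI[of _ 0]) simp
  from exclusion_lipschitz[where w = w and g = "\<lambda>_. 0" and x = x and y = y and k = k,
      OF assms this]
  show ?thesis by (simp add: abs_minus_commute)
qed

section \<open>From the sampling pmf to the recursion\<close>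

text \<open>Conditioning on the first draw. The functional \<open>h\<close> is general because it is
  used both with a membership indicator and with the total utility.\<close>

lemma expectation_softmax_draws_Suc:
  fixes v :: "real^'n" and h :: "'n set \<Rightarrow> real"
  assumes "R \<noteq> {}"
  shows "measure_pmf.expectation (softmax_draws \<tau> v (Suc k) R) h =
    (\<Sum>a\<in>R. exp (v $ a / \<tau>) / (\<Sum>j\<in>R. exp (v $ j / \<tau>)) *
      measure_pmf.expectation (softmax_draws \<tau> v k (R - {a})) (\<lambda>S. h (insert a S)))"
proof -
  have "set_pmf (softmax_pick \<tau> v R) \<subseteq> R"
    using assms by (auto simp: set_pmf_eq pmf_softmax_pick split: if_splits)
  then have "measure_pmf.expectation (softmax_draws \<tau> v (Suc k) R) h =
    (\<Sum>a\<in>R. pmf (softmax_pick \<tau> v R) a *\<^sub>R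
      measure_pmf.expectation (map_pmf (insert a) (softmax_draws \<tau> v k (R - {a}))) h)"
    unfolding softmax_draws.simps by (intro pmf_expectation_bind) auto
  also have "\<dots> = (\<Sum>a\<in>R. exp (v $ a / \<tau>) / (\<Sum>j\<in>R. exp (v $ j / \<tau>)) *
      measure_pmf.expectation (softmax_draws \<tau> v k (R - {a})) (\<lambda>S. h (insert a S)))"
    using assms by (intro sum.cong refl) (simp add: pmf_softmax_pick)
  finally show ?thesis .
qed

text \<open>The bound \<open>k \<le> card R\<close> keeps every pick on a nonempty set, where
  \<open>softmax_pick\<close> has its intended law.\<close>

lemma set_pmf_softmax_draws:
  fixes v :: "real^'n"
  assumes "k \<le> card R" "S \<in> set_pmf (softmax_draws \<tau> v k R)"
  shows "S \<subseteq> R \<and> card S = k"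
  using assms
proof (induction k arbitrary: R S)
  case (Suc k)
  have "R \<noteq> {}" using Suc.prems by auto
  then have sub: "set_pmf (softmax_pick \<tau> v R) \<subseteq> R"
    by (auto simp: set_pmf_eq pmf_softmax_pick split: if_splits)
  from Suc.prems(2) obtain a S' where a: "a \<in> set_pmf (softmax_pick \<tau> v R)"
    and S': "S' \<in> set_pmf (softmax_draws \<tau> v k (R - {a}))" "S = insert a S'"
    by auto
  have "a \<in> R" using a sub by auto
  then have "S' \<subseteq> R - {a} \<and> card S' = k"
    using Suc.prems S' by (intro Suc.IH) auto
  moreover from this have "a \<notin> S'" by auto
  ultimately show ?case using \<open>a \<in> R\<close> S' finite[of S'] by (auto simp: card_insert_if)
qed auto

lemma prob_softmax_draws:
  fixes v :: "real^'n"
  assumes "k \<le> card R"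
  shows "measure_pmf.prob (softmax_draws \<tau> v k R) {S. i \<in> S} = inclusion_prob (\<lambda>a. exp (v $ a / \<tau>)) k R i"
proof -
  have "measure_pmf.expectation (softmax_draws \<tau> v k R) (\<lambda>S. indicator {S. i \<in> S} S :: real) =
    inclusion_prob (\<lambda>a. exp (v $ a / \<tau>)) k R i"
    using assms
  proof (induction k arbitrary: R)
    case (Suc k)
    have R: "R \<noteq> {}" using Suc.prems by auto
    have "measure_pmf.expectation (softmax_draws \<tau> v k (R - {a}))
      (\<lambda>S. indicator {S. i \<in> S} (insert a S)) =
      (if a = i then 1 else inclusion_prob (\<lambda>a. exp (v $ a / \<tau>)) k (R - {a}) i)" if "a \<in> R" for a
    proof (cases "a = i")
      case False
      then have "indicator {S. i \<in> S} (insert a S) = (indicator {S. i \<in> S} S :: real)" for S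
        by (auto simp: indicator_def)
      then show ?thesis using False that Suc by simp
    qed simp
    then show ?case
      unfolding expectation_softmax_draws_Suc[OF R] inclusion_prob.simps by (intro sum.cong) simp_all
  qed simp
  then show ?thesis by simp
qed

text \<open>Linearity of expectation over membership indicators. With \<open>c = 1\<close> it gives
  the total of the marginals, with the utilities as \<open>c\<close> the inner product in
  \<open>regret\<close>.\<close>

lemma expectation_sum_members:
  fixes p :: "'a::finite set pmf" and c :: "'a \<Rightarrow> real"
  shows "measure_pmf.expectation p (\<lambda>S. sum c S) =
    (\<Sum>i\<in>UNIV. measure_pmf.prob p {S. i \<in> S} * c i)"
proof -
  have "sum c S = (\<Sum>i\<in>UNIV. indicator {S. i \<in> S} S * c i)" for S :: "'a set"
    by (simp add: indicator_def if_distrib[of "\<lambda>x. x * _"] sum.If_cases cong: if_cong)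
  then have "measure_pmf.expectation p (\<lambda>S. sum c S) =
    measure_pmf.expectation p (\<lambda>S. \<Sum>i\<in>UNIV. indicator {S. i \<in> S} S * c i)"
    by presburger
  also have "\<dots> = (\<Sum>i\<in>UNIV. measure_pmf.expectation p (\<lambda>S. indicator {S. i \<in> S} S * c i))"
    by (intro Bochner_Integration.integral_sum integrable_measure_pmf_finite) simp
  also have "\<dots> = (\<Sum>i\<in>UNIV. measure_pmf.prob p {S. i \<in> S} * c i)"
    by simp
  finally show ?thesis .
qed

section \<open>Smoothness of the marginals in the utilities\<close>

text \<open>Selection probabilities as a function of the utility vector alone: changing one
  coordinate at a time passes through vectors that need not be of the form
  \<open>u X\<close>.\<close>

definition marginals :: "nat \<Rightarrow> real \<Rightarrow> real^'n \<Rightarrow> real^'n"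
  where "marginals k \<tau> v = (\<chi> i. measure_pmf.prob (topk_softmax k \<tau> v) {S. i \<in> S})"

lemma selection_prob_eq_marginals: "selection_prob k \<tau> u X = marginals k \<tau> (u X)"
  by (simp add: selection_prob_def marginals_def)

lemma marginals_nth:
  fixes v :: "real^'n"
  assumes "k \<le> CARD('n)"
  shows "marginals k \<tau> v $ i = inclusion_prob (\<lambda>a. exp (v $ a / \<tau>)) k UNIV i"
  using assms by (simp add: marginals_def topk_softmax_def prob_softmax_draws)

lemma sum_marginals:
  fixes v :: "real^'n"
  assumes "k \<le> CARD('n)"
  shows "(\<Sum>i\<in>UNIV. marginals k \<tau> v $ i) = real k"
proof -
  let ?p = "topk_softmax k \<tau> v"
  have "(\<Sum>i\<in>UNIV. marginals k \<tau> v $ i) = measure_pmf.expectation ?p (\<lambda>S. \<Sum>i\<in>S. 1 :: real)"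
    unfolding expectation_sum_members by (simp add: marginals_def)
  also have "\<dots> = measure_pmf.expectation ?p (\<lambda>_. real k)"
    using set_pmf_softmax_draws[of k UNIV _ \<tau> v] assms
    by (intro integral_cong_AE) (auto simp: AE_measure_pmf_iff topk_softmax_def)
  finally show ?thesis by simp
qed

lemma norm1_minus_commute: "norm1 (x - y) = norm1 (y - x)"
  by (simp add: norm1_def abs_minus_commute)

lemma norm1_triangle: "norm1 (x - z) \<le> norm1 (x - y) + norm1 (y - z)"
  unfolding norm1_def sum.distrib[symmetric] by (intro sum_mono) simp

text \<open>
  Raising one utility raises that item's marginal and lowers all others; as the marginals sum
  to \<open>k\<close>, the total change is twice the change at the raised item.
\<close>

lemma marginals_coordinate_mono:
  fixes v v' :: "real^'n"
  assumes k: "k \<le> CARD('n)" and \<tau>: "\<tau> > 0"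
    and eq: "\<And>i. i \<noteq> j \<Longrightarrow> v $ i = v' $ i" and le: "v $ j \<le> v' $ j"
  shows "norm1 (marginals k \<tau> v - marginals k \<tau> v') \<le> 2 / (exp 1 * \<tau>) * \<bar>v $ j - v' $ j\<bar>"
proof -
  define w w' where "w a = exp (v $ a / \<tau>)" and "w' a = exp (v' $ a / \<tau>)" for a
  let ?R = "UNIV - {j}"
  have ins: "insert j ?R = UNIV" by auto
  have P: "marginals k \<tau> v $ i = inclusion_prob w k UNIV i" "marginals k \<tau> v' $ i = inclusion_prob w' k UNIV i" for i
    using k by (simp_all add: marginals_nth w_def[abs_def] w'_def[abs_def])
  have pos: "w a > 0" "w' a > 0" for a
    by (simp_all add: w_def w'_def)
  have weq: "w a = w' a" if "a \<noteq> j" for a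
    using eq[OF that] by (simp add: w_def w'_def)
  have lej: "w j \<le> w' j"
    using le \<tau> by (simp add: w_def w'_def divide_right_mono)
  have anti: "marginals k \<tau> v' $ i \<le> marginals k \<tau> v $ i" if "i \<noteq> j" for i
  proof (cases k)
    case (Suc k')
    \<comment> \<open>The run without \<open>j\<close> does not see the changed weight, so comparing
      excesses amounts to comparing marginals.\<close>
    have "inclusion_prob w' k' ?R i = inclusion_prob w k' ?R i"
      using weq by (intro inclusion_prob_cong) auto
    moreover have "inclusion_prob w' (Suc k') (insert j ?R) i - inclusion_prob w' k' ?R i
        \<le> inclusion_prob w (Suc k') (insert j ?R) i - inclusion_prob w k' ?R i"
      using that weq lej pos by (intro inclusion_prob_insert_excess_antimono[THEN conjunct2]) auto
    ultimately show ?thesis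
      unfolding P unfolding Suc ins by (simp del: inclusion_prob.simps)
  qed (simp add: marginals_def topk_softmax_def)
  \<comment> \<open>The log-weight of \<open>j\<close> is \<open>v $ j / \<tau>\<close>; this
    scaling puts \<open>1 / \<tau>\<close> into the constant.\<close>
  have "w = w(j := exp (v $ j / \<tau>))" "w' = w(j := exp (v' $ j / \<tau>))"
    using eq by (auto simp: fun_eq_iff w_def w'_def)
  then have "\<bar>marginals k \<tau> v $ j - marginals k \<tau> v' $ j\<bar> \<le> exp (- 1) * \<bar>v $ j / \<tau> - v' $ j / \<tau>\<bar>"
    unfolding P using inclusion_prob_self_lipschitz[where R = ?R and j = j and w = w and k = k
      and x = "v $ j / \<tau>" and y = "v' $ j / \<tau>"] pos ins by simp
  also have "\<dots> = 1 / (exp 1 * \<tau>) * \<bar>v $ j - v' $ j\<bar>"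
    using \<tau> by (simp add: exp_minus divide_inverse abs_mult flip: left_diff_distrib)
  finally have j: "\<bar>marginals k \<tau> v $ j - marginals k \<tau> v' $ j\<bar> \<le> 1 / (exp 1 * \<tau>) * \<bar>v $ j - v' $ j\<bar>" .
  have S: "(\<Sum>i\<in>UNIV. f i) = f j + (\<Sum>i\<in>?R. f i)" for f :: "'n \<Rightarrow> real"
    by (simp add: sum.remove)
  have "(\<Sum>i\<in>UNIV. marginals k \<tau> v $ i - marginals k \<tau> v' $ i) = 0"
    using sum_marginals[OF k] by (simp add: sum_subtractf)
  moreover have "(\<Sum>i\<in>?R. \<bar>marginals k \<tau> v $ i - marginals k \<tau> v' $ i\<bar>) =
      (\<Sum>i\<in>?R. marginals k \<tau> v $ i - marginals k \<tau> v' $ i)"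
    using anti by (intro sum.cong) auto
  ultimately have "norm1 (marginals k \<tau> v - marginals k \<tau> v') \<le>
      2 * \<bar>marginals k \<tau> v $ j - marginals k \<tau> v' $ j\<bar>"
    unfolding norm1_def by (simp add: S)
  with j show ?thesis by simp
qed

lemma marginals_coordinate:
  fixes v v' :: "real^'n"
  assumes "k \<le> CARD('n)" "\<tau> > 0" and "\<And>i. i \<noteq> j \<Longrightarrow> v $ i = v' $ i"
  shows "norm1 (marginals k \<tau> v - marginals k \<tau> v') \<le> 2 / (exp 1 * \<tau>) * \<bar>v $ j - v' $ j\<bar>"
proof (cases "v $ j \<le> v' $ j")
  case True
  with assms show ?thesis by (intro marginals_coordinate_mono)
next
  case False
  with assms have "norm1 (marginals k \<tau> v' - marginals k \<tau> v) \<le> 2 / (exp 1 * \<tau>) * \<bar>v' $ j - v $ j\<bar>"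
    by (intro marginals_coordinate_mono) auto
  then show ?thesis by (simp add: norm1_minus_commute abs_minus_commute)
qed

text \<open>Hybrid argument: \<open>mix A\<close> has already switched the coordinates in
  \<open>A\<close> from \<open>v\<close> to \<open>v'\<close>, and the costs of the single switches
  add up to the 1-norm.\<close>

lemma marginals_lipschitz:
  fixes v v' :: "real^'n"
  assumes "k \<le> CARD('n)" "\<tau> > 0"
  shows "norm1 (marginals k \<tau> v - marginals k \<tau> v') \<le> 2 / (exp 1 * \<tau>) * norm1 (v - v')"
proof -
  define mix where "mix A = (\<chi> i. if i \<in> A then v' $ i else v $ i)" for A
  have "norm1 (marginals k \<tau> v - marginals k \<tau> (mix A)) \<le>
      2 / (exp 1 * \<tau>) * (\<Sum>i\<in>A. \<bar>v $ i - v' $ i\<bar>)" if "finite A" for A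
    using that
  proof induction
    case empty
    have "mix {} = v" by (simp add: mix_def vec_eq_iff)
    then show ?case by (simp add: norm1_def)
  next
    case (insert j A)
    have "norm1 (marginals k \<tau> (mix A) - marginals k \<tau> (mix (insert j A))) \<le>
        2 / (exp 1 * \<tau>) * \<bar>mix A $ j - mix (insert j A) $ j\<bar>"
      using assms by (intro marginals_coordinate) (auto simp: mix_def)
    also have "\<dots> = 2 / (exp 1 * \<tau>) * \<bar>v $ j - v' $ j\<bar>"
      using insert by (simp add: mix_def)
    finally show ?case
      using insert norm1_triangle[of "marginals k \<tau> v" "marginals k \<tau> (mix (insert j A))"
          "marginals k \<tau> (mix A)"]
      by (simp add: distrib_left del: times_divide_eq_left)
  qed
  from this[of UNIV] show ?thesis
    by (simp add: mix_def norm1_def)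
qed

section \<open>Regret of the softmax draws\<close>

text \<open>The softmax mean is \<open>\<tau> * ln Z\<close> minus \<open>\<tau>\<close> times the
  entropy of \<open>q\<close>; here \<open>\<tau> * ln Z\<close> is at least \<open>x b\<close> and
  the entropy at most \<open>ln N\<close>. A bound \<open>N\<close> instead of \<open>card R\<close>
  makes the loss uniform over all draws.\<close>

lemma softmax_mean_ge:
  fixes x :: "'a \<Rightarrow> real"
  assumes "finite R" "b \<in> R" "card R \<le> N" and \<tau>: "\<tau> > 0"
  shows "x b - \<tau> * ln (real N) \<le>
    (\<Sum>a\<in>R. exp (x a / \<tau>) / (\<Sum>j\<in>R. exp (x j / \<tau>)) * x a)"
proof -
  define Z where "Z = (\<Sum>j\<in>R. exp (x j / \<tau>))"
  define q where "q a = exp (x a / \<tau>) / Z" for a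
  have Z: "Z > 0" unfolding Z_def using assms by (intro sum_pos) auto
  have q: "q a > 0" for a using Z by (simp add: q_def)
  have sq: "(\<Sum>a\<in>R. q a) = 1"
    using Z by (simp add: q_def Z_def flip: sum_divide_distrib)
  have "card R > 0" using assms by (auto simp: card_gt_0_iff)
  then have N: "real N > 0" using assms by linarith
  have xa: "x a = \<tau> * ln (q a) + \<tau> * ln Z" for a
    using Z \<tau> by (simp add: q_def ln_div field_simps)
  \<comment> \<open>Gibbs' inequality against the uniform value \<open>1 / N\<close>, term by term;
    summation leaves \<open>1 - card R / N\<close>, which is nonnegative.\<close>
  have "q a - 1 / N - q a * ln N \<le> q a * ln (q a)" for a
  proof -
    have "ln (1 / (q a * N)) \<le> 1 / (q a * N) - 1"
      using q[of a] N by (intro ln_le_minus_one) simp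
    then have "q a * (- ln (q a) - ln N) \<le> q a * (1 / (q a * N) - 1)"
      using q[of a] N by (intro mult_left_mono) (simp_all add: ln_div ln_mult)
    also have "\<dots> = 1 / N - q a" using q[of a] N by (simp add: field_simps)
    finally show ?thesis by (simp add: algebra_simps)
  qed
  then have "(\<Sum>a\<in>R. q a - 1 / N - q a * ln N) \<le> (\<Sum>a\<in>R. q a * ln (q a))"
    by (intro sum_mono)
  moreover have "(\<Sum>a\<in>R. q a - 1 / N - q a * ln N) = 1 - card R / N - ln N"
    using sq by (simp add: sum_subtractf flip: sum_distrib_right)
  moreover have "card R / N \<le> 1" using N assms(3) by simp
  ultimately have ent: "- ln N \<le> (\<Sum>a\<in>R. q a * ln (q a))" by linarith
  have "exp (x b / \<tau>) \<le> Z"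
    unfolding Z_def using assms by (intro member_le_sum) auto
  then have "x b / \<tau> \<le> ln Z"
    using Z by (simp add: ln_ge_iff)
  then have "x b \<le> \<tau> * ln Z" using \<tau> by (simp add: field_simps)
  moreover have "\<tau> * (- ln N) \<le> \<tau> * (\<Sum>a\<in>R. q a * ln (q a))"
    using ent \<tau> by (intro mult_left_mono) auto
  moreover have "(\<Sum>a\<in>R. q a * x a) = \<tau> * (\<Sum>a\<in>R. q a * ln (q a)) + \<tau> * ln Z"
  proof -
    have "(\<Sum>a\<in>R. q a * x a) = (\<Sum>a\<in>R. \<tau> * (q a * ln (q a)) + q a * (\<tau> * ln Z))"
      by (intro sum.cong refl, subst xa) (simp add: algebra_simps)
    also have "\<dots> = \<tau> * (\<Sum>a\<in>R. q a * ln (q a)) + (\<Sum>a\<in>R. q a) * (\<tau> * ln Z)"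
      by (simp only: sum.distrib sum_distrib_left sum_distrib_right)
    finally show ?thesis by (simp add: sq)
  qed
  ultimately have "x b - \<tau> * ln N \<le> (\<Sum>a\<in>R. q a * x a)" by simp
  then show ?thesis by (simp add: q_def Z_def)
qed

text \<open>Induction on the number of draws, each costing at most \<open>\<tau> * ln n\<close> with
  \<open>n = CARD('n)\<close>. The comparison set \<open>T\<close> is arbitrary, not optimal, so
  that it can lose any one element after each draw.\<close>

lemma expected_utility_ge:
  fixes v :: "real^'n"
  assumes "T \<subseteq> R" "card T = k" and \<tau>: "\<tau> > 0"
  shows "(\<Sum>i\<in>T. v $ i) - real k * \<tau> * ln (real CARD('n)) \<le>
    measure_pmf.expectation (softmax_draws \<tau> v k R) (\<lambda>S. \<Sum>i\<in>S. v $ i)"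
  using assms(1,2)
proof (induction k arbitrary: R T)
  case 0
  then show ?case by (simp add: card_eq_0_iff)
next
  case (Suc k)
  let ?E = "\<lambda>R. measure_pmf.expectation (softmax_draws \<tau> v k R) (\<lambda>S. \<Sum>i\<in>S. v $ i)"
  let ?l = "\<tau> * ln (real CARD('n))"
  define q where "q a = exp (v $ a / \<tau>) / (\<Sum>j\<in>R. exp (v $ j / \<tau>))" for a
  have R: "R \<noteq> {}" using Suc.prems by auto
  have q: "q a \<ge> 0" for a by (simp add: q_def sum_nonneg)
  have "(\<Sum>j\<in>R. exp (v $ j / \<tau>)) > 0" using R by (intro sum_pos) auto
  then have sq: "(\<Sum>a\<in>R. q a) = 1"
    by (simp add: q_def flip: sum_divide_distrib)
  have cR: "Suc k \<le> card R" using Suc.prems by (metis card_mono finite)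
  obtain b where b: "b \<in> R" "\<And>a. a \<in> R \<Longrightarrow> v $ a \<le> v $ b"
  proof -
    have "Max ((\<lambda>a. v $ a) ` R) \<in> (\<lambda>a. v $ a) ` R" using R by (intro Max_in) auto
    then obtain b where "b \<in> R" "Max ((\<lambda>a. v $ a) ` R) = v $ b" by auto
    moreover have "v $ a \<le> Max ((\<lambda>a. v $ a) ` R)" if "a \<in> R" for a
      using that by (intro Max_ge) auto
    ultimately show ?thesis using that by auto
  qed
  have split: "measure_pmf.expectation (softmax_draws \<tau> v k (R - {a})) (\<lambda>S. \<Sum>i\<in>insert a S. v $ i) =
      v $ a + ?E (R - {a})" if "a \<in> R" for a
  proof -
    have "measure_pmf.expectation (softmax_draws \<tau> v k (R - {a})) (\<lambda>S. \<Sum>i\<in>insert a S. v $ i) =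
       measure_pmf.expectation (softmax_draws \<tau> v k (R - {a})) (\<lambda>S. v $ a + (\<Sum>i\<in>S. v $ i))"
    proof (intro integral_cong_AE)
      have "k \<le> card (R - {a})" using cR that by simp
      then have "a \<notin> S" if "S \<in> set_pmf (softmax_draws \<tau> v k (R - {a}))" for S
        using set_pmf_softmax_draws that by blast
      then show "AE S in measure_pmf (softmax_draws \<tau> v k (R - {a})).
          (\<Sum>i\<in>insert a S. v $ i) = v $ a + (\<Sum>i\<in>S. v $ i)"
        by (auto simp: AE_measure_pmf_iff)
    qed auto
    also have "\<dots> = v $ a + ?E (R - {a})"
      by (subst Bochner_Integration.integral_add) (auto intro: integrable_measure_pmf_finite)
    finally show ?thesis .
  qed
  have IH: "(\<Sum>i\<in>T. v $ i) - v $ b - real k * ?l \<le> ?E (R - {a})" if "a \<in> R" for a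
  proof -
    \<comment> \<open>\<open>T\<close> gives up the drawn item if it contains it, otherwise any
      element. Either way it loses at most \<open>v $ b\<close>, which the first draw earns in
      expectation up to \<open>\<tau> * ln n\<close>.\<close>
    obtain c where c: "c \<in> T" "T - {c} \<subseteq> R - {a}"
    proof (cases "a \<in> T")
      case True
      then show ?thesis using Suc.prems that[of a] by auto
    next
      case False
      moreover obtain c where "c \<in> T" using Suc.prems by fastforce
      ultimately show ?thesis using Suc.prems that[of c] by auto
    qed
    have "(\<Sum>i\<in>T - {c}. v $ i) - real k * \<tau> * ln (real CARD('n)) \<le> ?E (R - {a})"
      using c Suc.prems by (intro Suc.IH) auto
    moreover have "(\<Sum>i\<in>T. v $ i) = v $ c + (\<Sum>i\<in>T - {c}. v $ i)"
      using c by (simp add: sum.remove)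
    moreover have "v $ c \<le> v $ b" using b c Suc.prems by auto
    ultimately show ?thesis by simp
  qed
  have "v $ b - ?l + ((\<Sum>i\<in>T. v $ i) - v $ b - real k * ?l) \<le>
      (\<Sum>a\<in>R. q a * v $ a) + (\<Sum>a\<in>R. q a) * ((\<Sum>i\<in>T. v $ i) - v $ b - real k * ?l)"
    unfolding sq using softmax_mean_ge[of R b "CARD('n)" \<tau> "\<lambda>a. v $ a"] b \<tau>
    by (simp add: q_def card_mono)
  also have "\<dots> = (\<Sum>a\<in>R. q a * (v $ a + ((\<Sum>i\<in>T. v $ i) - v $ b - real k * ?l)))"
    by (simp only: sum_distrib_right distrib_left sum.distrib)
  also have "\<dots> \<le> (\<Sum>a\<in>R. q a * (v $ a + ?E (R - {a})))"
    using IH q by (intro sum_mono mult_left_mono add_left_mono) auto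
  also have "\<dots> = measure_pmf.expectation (softmax_draws \<tau> v (Suc k) R) (\<lambda>S. \<Sum>i\<in>S. v $ i)"
    unfolding expectation_softmax_draws_Suc[OF R] q_def by (intro sum.cong refl) (simp add: split)
  finally show ?case by (simp add: algebra_simps)
qed

section \<open>The sum of the \<open>k\<close> largest entries as a maximum over
  \<open>k\<close>-sets\<close>

lemma sum_k_largest_attained:
  fixes v :: "real^'n"
  assumes k: "k \<le> CARD('n)"
  obtains T where "card T = k" "sum_k_largest k v = (\<Sum>i\<in>T. v $ i)"
    "\<And>S. card S = k \<Longrightarrow> (\<Sum>i\<in>S. v $ i) \<le> sum_k_largest k v"
proof -
  obtain zs :: "'n list" where zs: "set zs = UNIV" "distinct zs"
    using finite_distinct_list[OF finite, of UNIV] by auto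
  \<comment> \<open>Items are sorted rather than values, so that even with ties the last
    \<open>k\<close> entries form a set of exactly \<open>k\<close> items.\<close>
  define xs where "xs = sort_key (\<lambda>i. v $ i) zs"
  have xs: "set xs = UNIV" "distinct xs" "sorted (map (\<lambda>i. v $ i) xs)"
    using zs by (simp_all add: xs_def)
  have len: "length xs = CARD('n)" using xs distinct_card by metis
  have "image_mset (\<lambda>i. v $ i) (mset_set UNIV) = mset (map (\<lambda>i. v $ i) xs)"
    using mset_set_set[OF xs(2)] xs(1) by simp
  then have "sorted_list_of_multiset (image_mset (\<lambda>i. v $ i) (mset_set UNIV)) = map (\<lambda>i. v $ i) xs"
    using xs(3) by (simp add: sorted_sort_id del: mset_map)
  then have eq: "sum_k_largest k v = sum_list (map (\<lambda>i. v $ i) (take k (rev xs)))"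
    by (simp add: sum_k_largest_def rev_map take_map)
  define T where "T = set (take k (rev xs))"
  have d: "distinct (take k (rev xs))" using xs by simp
  have T: "card T = k" unfolding T_def using distinct_card[OF d] len k by simp
  have sT: "sum_k_largest k v = (\<Sum>i\<in>T. v $ i)"
    unfolding eq T_def using d by (simp add: sum_list_distinct_conv_sum_set)
  have "sorted_wrt (\<lambda>i j. v $ j \<le> v $ i) (rev xs)"
    using xs(3) by (simp add: sorted_wrt_rev sorted_map)
  then have "sorted_wrt (\<lambda>i j. v $ j \<le> v $ i) (take k (rev xs) @ drop k (rev xs))" by simp
  then have dom: "v $ b \<le> v $ a" if "a \<in> T" "b \<in> set (drop k (rev xs))" for a b
    using that unfolding sorted_wrt_append T_def by blast
  have "b \<in> set (drop k (rev xs))" if "b \<notin> T" for b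
    using that xs(1) unfolding T_def
    by (metis UNIV_I Un_iff append_take_drop_id set_append set_rev)
  with dom have dom: "v $ b \<le> v $ a" if "a \<in> T" "b \<notin> T" for a b
    using that by blast
  show thesis
  proof (rule that[OF T sT])
    fix S :: "'n set" assume S: "card S = k"
    \<comment> \<open>Exchange argument: every item of \<open>T\<close> is at least as good as every
      item outside, so any bijection between the two differences will do.\<close>
    have "card (S - T) = card (T - S)"
      using S T card_Diff_subset_Int[of S T] card_Diff_subset_Int[of T S] by (simp add: Int_commute)
    then obtain h where h: "bij_betw h (S - T) (T - S)"
      using finite_same_card_bij[of "S - T" "T - S"] by auto
    have "(\<Sum>i\<in>S - T. v $ i) \<le> (\<Sum>i\<in>S - T. v $ h i)"
      using h by (intro sum_mono dom) (auto simp: bij_betw_def)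
    also have "\<dots> = (\<Sum>i\<in>T - S. v $ i)" using h by (rule sum.reindex_bij_betw)
    finally show "(\<Sum>i\<in>S. v $ i) \<le> sum_k_largest k v"
      unfolding sT using sum.Int_Diff[of S "\<lambda>i. v $ i" T] sum.Int_Diff[of T "\<lambda>i. v $ i" S]
      by (simp add: Int_commute)
  qed
qed

text \<open>A set that is optimal for \<open>v\<close> is still a candidate for
  \<open>v'\<close>.\<close>

lemma sum_k_largest_diff_le:
  fixes v v' :: "real^'n"
  assumes "k \<le> CARD('n)"
  shows "sum_k_largest k v - sum_k_largest k v' \<le> norm1 (v - v')"
proof -
  obtain T where T: "card T = k" "sum_k_largest k v = (\<Sum>i\<in>T. v $ i)"
    using sum_k_largest_attained[OF assms] by metis
  have "(\<Sum>i\<in>T. v' $ i) \<le> sum_k_largest k v'"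
    using sum_k_largest_attained[OF assms] T(1) by metis
  then have "sum_k_largest k v - sum_k_largest k v' \<le> (\<Sum>i\<in>T. v $ i - v' $ i)"
    using T by (simp add: sum_subtractf)
  also have "\<dots> \<le> (\<Sum>i\<in>T. \<bar>v $ i - v' $ i\<bar>)" by (intro sum_mono) simp
  also have "\<dots> \<le> norm1 (v - v')"
    unfolding norm1_def by (simp add: sum_mono2)
  finally show ?thesis .
qed

section \<open>Continuity and compactness, for attaining the worst case\<close>

lemma norm_le_norm1: "norm v \<le> norm1 v"
  unfolding norm1_def by (rule norm_le_l1_cart)

lemma norm1_le_norm:
  fixes v :: "real^'n"
  shows "norm1 v \<le> real CARD('n) * norm v"
  unfolding norm1_def using sum_bounded_above[of UNIV "\<lambda>i. \<bar>v $ i\<bar>" "norm v"]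
  by (simp add: component_le_norm_cart)

lemma norm11_le_norm:
  fixes A :: "real^'m^'n"
  shows "norm11 A \<le> real CARD('n) * (real CARD('m) * norm A)"
proof -
  have "(\<Sum>j\<in>UNIV. \<bar>A $ i $ j\<bar>) \<le> real CARD('m) * norm A" for i
  proof -
    have "(\<Sum>j\<in>UNIV. \<bar>A $ i $ j\<bar>) \<le> real CARD('m) * norm (A $ i)"
      using norm1_le_norm[of "A $ i"] by (simp add: norm1_def)
    also have "\<dots> \<le> real CARD('m) * norm A"
      by (intro mult_left_mono Finite_Cartesian_Product.norm_nth_le) auto
    finally show ?thesis .
  qed
  then show ?thesis
    unfolding norm11_def using sum_bounded_above[of UNIV "\<lambda>i. \<Sum>j\<in>UNIV. \<bar>A $ i $ j\<bar>"] by simp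
qed

lemma continuous_on_norm1_lipschitz:
  fixes f :: "real^'n \<Rightarrow> 'b::real_normed_vector"
  assumes "C \<ge> 0" "\<And>x y. norm (f x - f y) \<le> C * norm1 (x - y)"
  shows "continuous_on UNIV f"
proof (rule lipschitz_on_continuous_on)
  show "(C * real CARD('n))-lipschitz_on UNIV f"
  proof (rule lipschitz_onI)
    fix x y
    have "norm (f x - f y) \<le> C * (real CARD('n) * norm (x - y))"
      using assms norm1_le_norm by (meson mult_left_mono order_trans)
    then show "dist (f x) (f y) \<le> C * real CARD('n) * dist x y"
      by (simp add: dist_norm)
  qed (use assms in simp)
qed

lemma continuous_on_lipschitz_utility:
  fixes u :: "real^'m^'n \<Rightarrow> real^'n"
  assumes "lipschitz_utility lam u"
  shows "continuous_on review_matrices u"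
proof (rule lipschitz_on_continuous_on)
  \<comment> \<open>The absolute value is taken since \<open>lipschitz_on\<close> demands a
    nonnegative constant and the sign of \<open>lam\<close> is not assumed.\<close>
  show "(\<bar>lam\<bar> * (real CARD('n) * real CARD('m)))-lipschitz_on review_matrices u"
  proof (rule lipschitz_onI)
    fix X Y :: "real^'m^'n" assume "X \<in> review_matrices" "Y \<in> review_matrices"
    then have "norm1 (u X - u Y) \<le> lam * norm11 (X - Y)"
      using assms by (simp add: lipschitz_utility_def)
    also have "\<dots> \<le> \<bar>lam\<bar> * norm11 (X - Y)"
      by (intro mult_right_mono) (auto simp: norm11_def sum_nonneg)
    also have "\<dots> \<le> \<bar>lam\<bar> * (real CARD('n) * (real CARD('m) * norm (X - Y)))"
      by (intro mult_left_mono norm11_le_norm) auto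
    finally show "dist (u X) (u Y) \<le> \<bar>lam\<bar> * (real CARD('n) * real CARD('m)) * dist X Y"
      using norm_le_norm1[of "u X - u Y"] by (simp add: dist_norm mult.assoc)
  qed simp
qed

lemma compact_review_matrices: "compact (review_matrices :: (real^'m^'n) set)"
proof -
  have "closed (review_matrices :: (real^'m^'n) set)"
    unfolding review_matrices_def atLeastAtMost_iff
    by (intro closed_Collect_all closed_Collect_conj closed_Collect_le continuous_intros)
  moreover have "norm X \<le> real CARD('n) * real CARD('m)" if "X \<in> review_matrices" for X :: "real^'m^'n"
  proof -
    have "norm (X $ i) \<le> real CARD('m)" for i
    proof -
      have "norm (X $ i) \<le> (\<Sum>j\<in>UNIV. \<bar>X $ i $ j\<bar>)" by (rule norm_le_l1_cart)
      also have "\<dots> \<le> (\<Sum>j\<in>(UNIV :: 'm set). 1)"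
        using that by (intro sum_mono) (auto simp: review_matrices_def)
      finally show ?thesis by simp
    qed
    then have "(\<Sum>i\<in>UNIV. norm (X $ i)) \<le> real CARD('n) * real CARD('m)"
      using sum_bounded_above[of UNIV "\<lambda>i. norm (X $ i)"] by simp
    moreover have "norm X \<le> (\<Sum>i\<in>UNIV. norm (X $ i))"
      unfolding norm_vec_def by (rule L2_set_le_sum) simp
    ultimately show ?thesis by linarith
  qed
  then have "bounded (review_matrices :: (real^'m^'n) set)"
    unfolding bounded_iff by blast
  ultimately show ?thesis by (simp add: compact_eq_bounded_closed)
qed

text \<open>Serves to make the worst-case regret a maximum that is attained; the continuity of the
  marginals comes from their smoothness.\<close>

lemma continuous_on_regret:
  fixes u :: "real^'m^'n \<Rightarrow> real^'n"
  assumes k: "k \<le> CARD('n)" and \<tau>: "\<tau> > 0" and u: "lipschitz_utility lam u"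
  shows "continuous_on review_matrices (regret k \<tau> u)"
proof -
  note cu = continuous_on_lipschitz_utility[OF u]
  have "continuous_on UNIV (marginals k \<tau> :: real^'n \<Rightarrow> real^'n)"
    using marginals_lipschitz[OF k \<tau>] norm_le_norm1 \<tau>
    by (intro continuous_on_norm1_lipschitz[where C = "2 / (exp 1 * \<tau>)"]) (auto intro: order_trans)
  then have cm: "continuous_on review_matrices (\<lambda>X. marginals k \<tau> (u X))"
    using cu by (rule continuous_on_compose2) auto
  have "\<bar>sum_k_largest k v - sum_k_largest k v'\<bar> \<le> norm1 (v - v')" for v v' :: "real^'n"
    using sum_k_largest_diff_le[OF k, of v v'] sum_k_largest_diff_le[OF k, of v' v]
    by (simp add: abs_le_iff norm1_minus_commute)
  then have "continuous_on UNIV (sum_k_largest k :: real^'n \<Rightarrow> real)"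
    by (intro continuous_on_norm1_lipschitz[where C = 1]) auto
  then have "continuous_on review_matrices (\<lambda>X. sum_k_largest k (u X))"
    using cu by (rule continuous_on_compose2) auto
  then have "continuous_on review_matrices
      (\<lambda>X. sum_k_largest k (u X) - marginals k \<tau> (u X) \<bullet> u X)"
    using cm cu by (intro continuous_intros)
  then show ?thesis
    unfolding regret_def selection_prob_eq_marginals .
qed

lemma regret_le:
  fixes u :: "real^'m^'n \<Rightarrow> real^'n"
  assumes k: "k \<le> CARD('n)" and \<tau>: "\<tau> > 0"
  shows "regret k \<tau> u X \<le> real k * \<tau> * ln (real CARD('n))"
proof -
  obtain T where T: "card T = k" "sum_k_largest k (u X) = (\<Sum>i\<in>T. u X $ i)"
    using sum_k_largest_attained[OF k] by metis
  have "selection_prob k \<tau> u X \<bullet> u X =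
      measure_pmf.expectation (topk_softmax k \<tau> (u X)) (\<lambda>S. \<Sum>i\<in>S. u X $ i)"
    unfolding expectation_sum_members by (simp add: selection_prob_def inner_vec_def)
  then show ?thesis
    using expected_utility_ge[of T UNIV, OF subset_UNIV T(1) \<tau>, of "u X"] T(2)
    by (simp add: regret_def topk_softmax_def)
qed

section \<open>Smoothness and worst-case regret combined\<close>

theorem theorem4:
  fixes u :: "real^'m^'n \<Rightarrow> real^'n" and k :: nat and lam \<tau> :: real
  assumes "1 \<le> k" and "k \<le> CARD('n)"
    and "lipschitz_utility lam u"
    and "\<tau> > 0"
  shows "(\<exists>L. L \<le> 2 * lam / (exp 1 * \<tau>) \<and> smooth_selection L (selection_prob k \<tau> u)) \<and>
    (\<exists>X0\<in>review_matrices. (\<forall>X\<in>review_matrices. regret k \<tau> u X \<le> regret k \<tau> u X0) \<and>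
      regret k \<tau> u X0 \<le> real k * \<tau> * ln (real CARD('n)))"
proof
  have "smooth_selection (2 * lam / (exp 1 * \<tau>)) (selection_prob k \<tau> u)"
    unfolding smooth_selection_def selection_prob_eq_marginals
  proof (intro ballI)
    fix X X' :: "real^'m^'n" assume "X \<in> review_matrices" "X' \<in> review_matrices"
    then have "norm1 (u X - u X') \<le> lam * norm11 (X - X')"
      using assms(3) by (simp add: lipschitz_utility_def)
    then have "2 / (exp 1 * \<tau>) * norm1 (u X - u X') \<le> 2 / (exp 1 * \<tau>) * (lam * norm11 (X - X'))"
      using assms(4) by (intro mult_left_mono) auto
    with marginals_lipschitz[OF assms(2,4), of "u X" "u X'"]
    show "norm1 (marginals k \<tau> (u X) - marginals k \<tau> (u X')) \<le>
        2 * lam / (exp 1 * \<tau>) * norm11 (X - X')"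
      by simp
  qed
  then show "\<exists>L. L \<le> 2 * lam / (exp 1 * \<tau>) \<and> smooth_selection L (selection_prob k \<tau> u)"
    by blast
next
  \<comment> \<open>Attaining a maximum requires a nonempty domain.\<close>
  have "(0 :: real^'m^'n) \<in> review_matrices" by (simp add: review_matrices_def)
  then obtain X0 :: "real^'m^'n" where "X0 \<in> review_matrices"
    "\<forall>X\<in>review_matrices. regret k \<tau> u X \<le> regret k \<tau> u X0"
    using continuous_attains_sup[OF compact_review_matrices _ continuous_on_regret[OF assms(2,4,3)]]
    by blast
  then show "\<exists>X0\<in>review_matrices. (\<forall>X\<in>review_matrices. regret k \<tau> u X \<le> regret k \<tau> u X0) \<and>
      regret k \<tau> u X0 \<le> real k * \<tau> * ln (real CARD('n))"
    using regret_le[OF assms(2,4)] by blast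
qed

end
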